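(* Let $N\ge 2$ be an integer, $a>0$, $b>0$, $m>0$, $h\ge 0$ and $0\le\theta<2\pi/N$. Put $A=\sum_{1\le j\le N-1}\frac{1-\rho_j}{|1-\rho_j|^3}$ and $\theta_j=2\pi j/N$, $\rho_j=e^{i\theta_j}$. (i) Suppose $h=0$ and $a\ne 1$. The configuration formed by two twisted regular $N$-gons with parameters $(N,a,b,m,h,\theta)$ is a central configuration if and only if one of the following holds: $\theta=0$ and $$b\left[\sum_{1\le j\le N}\frac{1-a\cos(\theta_j)}{(1+a^2-2a\cos(\theta_j))^{3/2}}-\frac{A}{a^3}\right]=\sum_{1\le j\le N}\frac{1-a^{-1}\cos(\theta_j)}{(1+a^2-2a\cos(\theta_j))^{3/2}}-A,$$ or $\theta=\pi/N$ and $$b\left[\sum_{1\le j\le N}\frac{1-a\cos(\theta_j+\frac{\pi}{N})}{(1+a^2-2a\cos(\theta_j+\frac{\pi}{N}))^{3/2}}-\frac{A}{a^3}\right]=\sum_{1\le j\le N}\frac{1-a^{-1}\cos(\theta_j+\frac{\pi}{N})}{(1+a^2-2a\cos(\theta_j+\frac{\pi}{N}))^{3/2}}-A.$$ (ii) Suppose $h>0$. The configuration formed by two twisted regular $N$-gons with parameters $(N,a,b,m,h,\theta)$ is a central configuration if and only if one of the following holds: $\theta=0$ and both $$ba\sum_{1\le j\le N}\frac{\cos(\theta_j)}{(1+a^2-2a\cos(\theta_j)+h^2)^{3/2}}=A-\sum_{1\le j\le N}\frac{1}{(1+a^2-2a\cos(\theta_j)+h^2)^{3/2}},$$ $$ba\left(\frac{A}{a^3}-\sum_{1\le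 j\le N}\frac{1}{(1+a^2-2a\cos(\theta_j)+h^2)^{3/2}}\right)=\sum_{1\le j\le N}\frac{\cos(\theta_j)}{(1+a^2-2a\cos(\theta_j)+h^2)^{3/2}},$$ or $\theta=\pi/N$ and both $$ba\sum_{1\le j\le N}\frac{\cos(\theta_j+\frac{\pi}{N})}{(1+a^2-2a\cos(\theta_j+\frac{\pi}{N})+h^2)^{3/2}}=A-\sum_{1\le j\le N}\frac{1}{(1+a^2-2a\cos(\theta_j+\frac{\pi}{N})+h^2)^{3/2}},$$ $$ba\left(\frac{A}{a^3}-\sum_{1\le j\le N}\frac{1}{(1+a^2-2a\cos(\theta_j+\frac{\pi}{N})+h^2)^{3/2}}\right)=\sum_{1\le j\le N}\frac{\cos(\theta_j+\frac{\pi}{N})}{(1+a^2-2a\cos(\theta_j+\frac{\pi}{N})+h^2)^{3/2}}.$$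
   Context: Identify $\mathbb{R}^3$ with $\mathbb{C}\times\mathbb{R}$. For $1\le k\le N$ let $\theta_k=2k\pi/N$, $\rho_k=e^{i\theta_k}$ and $\tilde\rho_k=a\rho_k e^{i\theta}$. The configuration formed by two twisted regular $N$-gons with parameters $(N,a,b,m,h,\theta)$ consists of $2N$ point masses: a mass $m$ at each point $q_k=(\rho_k,0)$ and a mass $bm$ at each point $\tilde q_k=(\tilde\rho_k,h)$, $1\le k\le N$. Here $h$ is the distance between the two layers and $\theta$ is the twisted angle. By the rotational symmetry of the polygons, $\theta$ matters only modulo $2\pi/N$. The number $A$ is real and positive. Central configuration: point masses $\mu_1,\dots,\mu_n>0$ at positions $x_1,\dots,x_n\in\mathbb{R}^3$ form a central configuration if the positions are pairwise distinct and, with $z_0=\left(\sum_j \mu_j x_j\right)/\left(\sum_j\mu_j\right)$ the center of mass and $y_k=x_k-z_0$, there is $\lambda\in\mathbb{R}$ such that $\sum_{j\ne k}\frac{\mu_j\mu_k}{|y_j-y_k|^3}(y_j-y_k)=-\lambda\mu_k y_k$ for all $1\le k\le n$. *)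

theory Defs
  imports "HOL-Analysis.Analysis"
begin

text \<open>The space R^3 is the type \<open>complex \<times> real\<close>, whose norm is the Euclidean one.
  A system of point masses is a family indexed by a finite set \<open>I\<close>.\<close>

definition center_of_mass :: "'i set \<Rightarrow> ('i \<Rightarrow> real) \<Rightarrow> ('i \<Rightarrow> complex \<times> real) \<Rightarrow> complex \<times> real" where
  "center_of_mass I \<mu> x = (\<Sum>j\<in>I. \<mu> j *\<^sub>R x j) /\<^sub>R (\<Sum>j\<in>I. \<mu> j)"

definition central_configuration :: "'i set \<Rightarrow> ('i \<Rightarrow> real) \<Rightarrow> ('i \<Rightarrow> complex \<times> real) \<Rightarrow> bool" where
  "central_configuration I \<mu> x \<longleftrightarrow>
     finite I \<and> I \<noteq> {} \<and> (\<forall>k\<in>I. 0 < \<mu> k) \<and> inj_on x I \<and>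
     (let y = (\<lambda>k. x k - center_of_mass I \<mu> x) in
      \<exists>l::real. \<forall>k\<in>I.
        (\<Sum>j\<in>I - {k}. (\<mu> j * \<mu> k / norm (y j - y k) ^ 3) *\<^sub>R (y j - y k)) = - (l * \<mu> k) *\<^sub>R y k)"

definition ngon_angle :: "nat \<Rightarrow> nat \<Rightarrow> real" where
  "ngon_angle N j = 2 * pi * real j / real N"

definition ngon_root :: "nat \<Rightarrow> nat \<Rightarrow> complex" where
  "ngon_root N j = cis (ngon_angle N j)"

text \<open>The \<open>2N\<close> bodies are indexed by \<open>{1..N} <+> {1..N}\<close>: \<open>Inl k\<close> is the \<open>k\<close>-th body of the
  lower polygon, \<open>Inr k\<close> the \<open>k\<close>-th body of the upper one.\<close>

definition twisted_ngons_mass :: "real \<Rightarrow> real \<Rightarrow> nat + nat \<Rightarrow> real" where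
  "twisted_ngons_mass b m = case_sum (\<lambda>k. m) (\<lambda>k. b * m)"

definition twisted_ngons_pos :: "nat \<Rightarrow> real \<Rightarrow> real \<Rightarrow> real \<Rightarrow> nat + nat \<Rightarrow> complex \<times> real" where
  "twisted_ngons_pos N a h \<theta> =
     case_sum (\<lambda>k. (ngon_root N k, 0)) (\<lambda>k. (of_real a * ngon_root N k * cis \<theta>, h))"

definition twisted_ngons_central ::
    "nat \<Rightarrow> real \<Rightarrow> real \<Rightarrow> real \<Rightarrow> real \<Rightarrow> real \<Rightarrow> bool" where
  "twisted_ngons_central N a b m h \<theta> \<longleftrightarrow>
     central_configuration ({1..N} <+> {1..N}) (twisted_ngons_mass b m) (twisted_ngons_pos N a h \<theta>)"

text \<open>The defining sum is complex but its value is real; \<open>of_real_ngon_A\<close> below shows that taking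
  the real part loses nothing.\<close>

definition ngon_A :: "nat \<Rightarrow> real" where
  "ngon_A N = Re (\<Sum>j\<in>{1..N - 1}. (1 - ngon_root N j) / of_real (norm (1 - ngon_root N j) ^ 3))"

lemma of_real_ngon_A:
  "complex_of_real (ngon_A N) =
     (\<Sum>j\<in>{1..N - 1}. (1 - ngon_root N j) / of_real (norm (1 - ngon_root N j) ^ 3))"
proof -
  define f where "f j = (1 - ngon_root N j) / of_real (norm (1 - ngon_root N j) ^ 3)" for j
  have root: "ngon_root N (N - j) = cnj (ngon_root N j)" if "j \<in> {1..N - 1}" for j
  proof -
    have "ngon_angle N (N - j) = 2 * pi - ngon_angle N j"
    proof -
      have "j \<le> N" "N \<noteq> 0"
        using that by auto
      then show ?thesis
        by (simp add: ngon_angle_def of_nat_diff field_simps)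
    qed
    then show ?thesis
      by (simp add: ngon_root_def complex_eq_iff cos_diff sin_diff)
  qed
  have "cnj (f j) = f (N - j)" if "j \<in> {1..N - 1}" for j
  proof -
    have "norm (1 - cnj (ngon_root N j)) = norm (1 - ngon_root N j)"
      by (metis complex_cnj_diff complex_cnj_one complex_mod_cnj)
    then show ?thesis
      using root[OF that] by (simp add: f_def)
  qed
  then have "cnj (sum f {1..N - 1}) = (\<Sum>j\<in>{1..N - 1}. f (N - j))"
    by simp
  also have "\<dots> = sum f {1..N - 1}"
    by (rule sum.reindex_bij_witness[where i = "\<lambda>j. N - j" and j = "\<lambda>j. N - j"]) auto
  finally have "Im (sum f {1..N - 1}) = 0"
    by (metis Reals_cnj_iff complex_is_Real_iff)
  then show ?thesis
    unfolding ngon_A_def f_def by (simp add: complex_eq_iff)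
qed

end

theory Submission
  imports Defs "HOL-Real_Asymp.Real_Asymp"
begin

text \<open>By rotational symmetry the equations of motion reduce to one body of each polygon. Dividing
  out the position of that body, the tangential components all say that
  \<open>S(\<theta>) = (\<Sum>j. sin (\<theta>\<^sub>j + \<theta>) / d\<^sub>j\<^sup>3)\<close> vanishes, where \<open>d\<^sub>j\<close> are the distances
  between the layers; the radial and vertical components are the stated identities after \<open>\<lambda>\<close>
  is eliminated.

  The zeros of \<open>S\<close> are those of \<open>sin (N\<theta>)\<close>. With \<open>D = d\<^sup>2\<close>, the factor \<open>D powr (-3/2)\<close> is
  \<open>4/\<pi>\<close> times the integral of \<open>1 / (D + u\<^sup>2)\<^sup>2\<close> over \<open>u \<ge> 0\<close>, so it suffices that
  \<open>\<Sum>j. sin \<phi>\<^sub>j / (C - 2a cos \<phi>\<^sub>j)\<^sup>2\<close> is a positive multiple of \<open>sin (N\<theta>)\<close>. This follows by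
  differentiating in \<open>R\<close> the closed form of \<open>\<Sum>j. sin \<phi>\<^sub>j / (R + 1/R - 2 cos \<phi>\<^sub>j)\<close>, which is the
  imaginary part of \<open>\<Sum>j. 1 / (1 - w \<rho>\<^sub>j) = N / (1 - w ^ N)\<close> at \<open>w = e^{i\<theta>} / R\<close>.\<close>

section \<open>Sums over the roots of unity\<close>

lemma ngon_root_N: "0 < N \<Longrightarrow> ngon_root N N = 1"
  by (simp add: ngon_root_def ngon_angle_def)

text \<open>The bodies are numbered from 1, whereas the standard enumeration of the roots starts at
  0. Index \<open>N\<close> takes the place of 0, since both give the root 1.\<close>

lemma bij_betw_ngon_root:
  assumes "0 < N"
  shows "bij_betw (ngon_root N) {1..N} {z. z ^ N = 1}"
proof -
  have "bij_betw (\<lambda>k. if k = N then 0 else k) {1..N} {..<N}"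
    using assms by (intro bij_betw_byWitness[where f' = "\<lambda>k. if k = 0 then N else k"]) auto
  from bij_betw_trans[OF this Complex.bij_betw_roots_unity[OF assms]]
  have "bij_betw ((\<lambda>k. cis (2 * pi * real k / real N)) \<circ> (\<lambda>k. if k = N then 0 else k)) {1..N} {z. z ^ N = 1}" .
  also have "?this \<longleftrightarrow> bij_betw (ngon_root N) {1..N} {z. z ^ N = 1}"
    using assms by (intro bij_betw_cong) (auto simp: ngon_root_def ngon_angle_def)
  finally show ?thesis .
qed

lemma sum_ngon_root:
  "0 < N \<Longrightarrow> (\<Sum>j\<in>{1..N}. f (ngon_root N j)) = (\<Sum>z | z ^ N = 1. f z)"
  by (rule sum.reindex_bij_betw[OF bij_betw_ngon_root])

lemma ngon_root_power: "0 < N \<Longrightarrow> k \<in> {1..N} \<Longrightarrow> ngon_root N k ^ N = 1"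
  using bij_betw_ngon_root[of N] by (auto dest: bij_betw_apply)

lemma norm_ngon_root [simp]: "norm (ngon_root N k) = 1"
  by (simp add: ngon_root_def)

lemma ngon_root_nonzero [simp]: "ngon_root N k \<noteq> 0"
  by (simp add: ngon_root_def)

lemma bij_betw_mult_root_unity:
  fixes c :: complex
  assumes "c ^ N = 1" "c \<noteq> 0"
  shows "bij_betw (\<lambda>z. z * c) {z. z ^ N = 1} {z. z ^ N = 1}"
  using assms
  by (intro bij_betw_byWitness[where f' = "\<lambda>z. z / c"]) (auto simp: power_mult_distrib power_divide)

text \<open>Multiplication by an \<open>N\<close>-th root of unity permutes the roots. This is the
  form in which the rotational symmetry of the polygons enters below.\<close>

lemma sum_ngon_root_mult:
  assumes "0 < N" "c ^ N = 1"
  shows "(\<Sum>j\<in>{1..N}. f (ngon_root N j * c)) = (\<Sum>j\<in>{1..N}. f (ngon_root N j))"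
proof -
  have "c \<noteq> 0" using assms by (metis power_0_left zero_neq_one less_numeral_extra(3))
  then show ?thesis
    using assms sum.reindex_bij_betw[OF bij_betw_mult_root_unity[of c N], of f]
    by (simp add: sum_ngon_root[where f="\<lambda>z. f (z * c)"] sum_ngon_root[where f=f] del: One_nat_def)
qed

lemma sum_ngon_root_inverse:
  assumes "0 < N"
  shows "(\<Sum>j\<in>{1..N}. f (inverse (ngon_root N j))) = (\<Sum>j\<in>{1..N}. f (ngon_root N j))"
proof -
  have "bij_betw inverse {z::complex. z ^ N = 1} {z. z ^ N = 1}"
    by (intro bij_betw_byWitness[where f' = inverse]) (auto simp: power_inverse)
  from sum.reindex_bij_betw[OF this, of f] show ?thesis
    using assms by (simp add: sum_ngon_root[where f="\<lambda>z. f (inverse z)"] sum_ngon_root[where f=f] del: One_nat_def)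
qed

text \<open>Rotating body \<open>k\<close> to position 1 turns the sum over its companions into the
  sum over the roots other than 1, which is the shape of the sum defining
  \<open>ngon_A\<close>.\<close>

lemma sum_ngon_root_delete:
  assumes "0 < N" "k \<in> {1..N}"
  shows "(\<Sum>j\<in>{1..N} - {k}. f (ngon_root N j / ngon_root N k)) = (\<Sum>j\<in>{1..N - 1}. f (ngon_root N j))"
proof -
  have p: "inverse (ngon_root N k) ^ N = 1"
    using ngon_root_power[OF assms] by (simp add: power_inverse)
  have inj: "ngon_root N j = ngon_root N k \<longleftrightarrow> j = k" if "j \<in> {1..N}" "k \<in> {1..N}" for j k
    using bij_betw_ngon_root[OF assms(1)] that by (auto simp: bij_betw_def dest: inj_onD)
  \<comment> \<open>Setting the summand to 0 at 1 restores the omitted index, so that the sum runs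
    over all roots and can be rotated.\<close>
  define g where "g z = (if z = 1 then 0 else f z)" for z
  have "(\<Sum>j\<in>{1..N} - {k}. f (ngon_root N j / ngon_root N k))
      = (\<Sum>j\<in>{1..N}. g (ngon_root N j * inverse (ngon_root N k)))"
    using assms inj by (intro sum.mono_neutral_cong_left) (auto simp: g_def divide_inverse[symmetric])
  also have "\<dots> = (\<Sum>j\<in>{1..N}. g (ngon_root N j))"
    by (rule sum_ngon_root_mult[OF assms(1) p])
  also have "\<dots> = (\<Sum>j\<in>{1..N - 1}. f (ngon_root N j))"
  proof (rule sum.mono_neutral_cong_right)
    show "\<forall>i\<in>{1..N} - {1..N - 1}. g (ngon_root N i) = 0"
    proof
      fix i assume "i \<in> {1..N} - {1..N - 1}"
      then have "i = N" by auto
      then show "g (ngon_root N i) = 0"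
        using ngon_root_N[OF assms(1)] by (simp add: g_def)
    qed
    show "g (ngon_root N i) = f (ngon_root N i)" if "i \<in> {1..N - 1}" for i
    proof -
      have "i \<in> {1..N}" "N \<in> {1..N}" "i \<noteq> N" using that by auto
      then show ?thesis
        using inj[of i N] ngon_root_N[OF assms(1)] by (simp add: g_def)
    qed
  qed auto
  finally show ?thesis .
qed

text \<open>A rotation by one step leaves the sum unchanged but also multiplies it by
  \<open>ngon_root N k\<close>, which differs from 1 for these \<open>k\<close>.\<close>

lemma sum_ngon_root_pow:
  assumes "0 < k" "k < N"
  shows "(\<Sum>j\<in>{1..N}. ngon_root N j ^ k) = 0"
proof -
  let ?T = "\<Sum>j\<in>{1..N}. ngon_root N j ^ k"
  have "?T = (\<Sum>j\<in>{1..N}. (ngon_root N j * ngon_root N 1) ^ k)"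
    using assms by (intro sum_ngon_root_mult[symmetric] ngon_root_power) auto
  also have "\<dots> = ?T * ngon_root N 1 ^ k"
    by (simp add: power_mult_distrib sum_distrib_right)
  finally have *: "?T * (ngon_root N 1 ^ k - 1) = 0" by (simp add: algebra_simps)
  have "ngon_root N 1 ^ k = ngon_root N k"
    by (simp add: ngon_root_def ngon_angle_def Complex.DeMoivre algebra_simps)
  moreover have "ngon_root N k \<noteq> ngon_root N N"
    using bij_betw_ngon_root[of N] assms by (auto simp: bij_betw_def dest!: inj_onD)
  ultimately show ?thesis using * ngon_root_N[of N] assms by auto
qed

text \<open>Since \<open>(w * ngon_root N j) ^ N = w ^ N\<close>, each summand is a finite geometric
  sum over the common denominator \<open>1 - w ^ N\<close>. Summing over \<open>j\<close> kills
  every power except the zeroth.\<close>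

lemma sum_inverse_one_minus_ngon_root:
  assumes "0 < N" "norm w < 1"
  shows "(\<Sum>j\<in>{1..N}. 1 / (1 - w * ngon_root N j)) = of_nat N / (1 - w ^ N)"
proof -
  have ne: "1 - w * ngon_root N j \<noteq> 0" for j
    using assms(2) by (metis eq_iff_diff_eq_0 mult.right_neutral norm_mult norm_ngon_root norm_one order_less_irrefl)
  have "norm (w ^ N) < 1"
    using assms by (simp add: norm_power power_less_one_iff)
  then have ne': "1 - w ^ N \<noteq> 0" by auto
  have "1 / (1 - w * ngon_root N j) = (\<Sum>k<N. w ^ k * ngon_root N j ^ k) / (1 - w ^ N)" if "j \<in> {1..N}" for j
    using one_diff_power_eq[of "w * ngon_root N j" N] ngon_root_power[OF assms(1) that] ne[of j] ne'
    by (simp add: power_mult_distrib field_simps)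
  then have "(\<Sum>j\<in>{1..N}. 1 / (1 - w * ngon_root N j))
      = (\<Sum>j\<in>{1..N}. \<Sum>k<N. w ^ k * ngon_root N j ^ k) / (1 - w ^ N)"
    by (simp add: sum_divide_distrib)
  also have "(\<Sum>j\<in>{1..N}. \<Sum>k<N. w ^ k * ngon_root N j ^ k) = (\<Sum>k<N. w ^ k * (\<Sum>j\<in>{1..N}. ngon_root N j ^ k))"
    by (subst sum.swap) (simp add: sum_distrib_left)
  also have "\<dots> = (\<Sum>k<N. if k = 0 then of_nat N else 0)"
    by (intro sum.cong refl) (auto simp: sum_ngon_root_pow simp del: One_nat_def)
  also have "\<dots> = of_nat N"
    using assms by simp
  finally show ?thesis .
qed

section \<open>Rational sine sums over a rotated polygon\<close>

lemma Im_inverse_one_minus: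
  assumes "1 < R"
  shows "Im (1 / (1 - cis \<phi> / of_real R)) = sin \<phi> / (R + 1 / R - 2 * cos \<phi>)"
proof -
  \<comment> \<open>The left side is the squared modulus of the denominator. Its factor
    \<open>1 / R\<close> cancels against the one in the imaginary part \<open>sin \<phi> / R\<close>
    of the conjugate.\<close>
  have "(1 - cos \<phi> / R)\<^sup>2 + (sin \<phi> / R)\<^sup>2 = (R + 1 / R - 2 * cos \<phi>) / R"
    using assms sin_cos_squared_add[of \<phi>] by (simp add: field_simps power2_eq_square)
  then show ?thesis
    using assms by (simp add: Im_divide power2_eq_square Re_divide_of_real Im_divide_of_real)
qed

lemma add_inverse_gt_two:
  assumes "(1::real) < R"
  shows "2 < R + 1 / R"
proof -
  have "0 < (R - 1)\<^sup>2 / R" using assms by simp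
  also have "(R - 1)\<^sup>2 / R = R + 1 / R - 2" using assms by (simp add: field_simps power2_eq_square)
  finally show ?thesis by simp
qed

text \<open>Imaginary part of the previous closed form at \<open>w = cis \<theta> / R\<close>.
  Because \<open>w ^ N\<close> has the same shape, with \<open>R ^ N\<close> and
  \<open>N\<theta>\<close> in place of \<open>R\<close> and \<open>\<theta>\<close>, one formula
  evaluates both sides.\<close>

lemma sum_sin_over_ngon:
  assumes "0 < N" "1 < R"
  shows "(\<Sum>j\<in>{1..N}. sin (ngon_angle N j + \<theta>) / (R + 1 / R - 2 * cos (ngon_angle N j + \<theta>)))
     = real N * (sin (real N * \<theta>) / (R ^ N + 1 / R ^ N - 2 * cos (real N * \<theta>)))"
proof -
  let ?w = "cis \<theta> / complex_of_real R"
  have "(\<Sum>j\<in>{1..N}. 1 / (1 - ?w * ngon_root N j)) = of_nat N / (1 - ?w ^ N)"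
    using assms by (intro sum_inverse_one_minus_ngon_root) (auto simp: norm_divide)
  also have "of_nat N / (1 - ?w ^ N) = of_real (real N) * (1 / (1 - cis (real N * \<theta>) / of_real (R ^ N)))"
    by (simp add: power_divide Complex.DeMoivre)
  finally have "Im (\<Sum>j\<in>{1..N}. 1 / (1 - ?w * ngon_root N j))
     = Im (of_real (real N) * (1 / (1 - cis (real N * \<theta>) / of_real (R ^ N))))"
    by simp
  moreover have "?w * ngon_root N j = cis (ngon_angle N j + \<theta>) / of_real R" for j
    by (simp add: ngon_root_def cis_mult add.commute)
  ultimately have "Im (\<Sum>j\<in>{1..N}. 1 / (1 - cis (ngon_angle N j + \<theta>) / of_real R))
     = Im (of_real (real N) * (1 / (1 - cis (real N * \<theta>) / of_real (R ^ N))))"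
    by (simp only:)
  then show ?thesis
    unfolding Im_sum Im_inverse_one_minus[OF assms(2)] times_complex.sel Re_complex_of_real Im_complex_of_real
      mult_zero_left add_0_right
      Im_inverse_one_minus[OF one_less_power[OF assms(2,1)]] .
qed

text \<open>Differentiation in \<open>R\<close> squares the denominators. The inner derivatives
  \<open>1 - 1 / R\<^sup>2\<close> on the left and a positive multiple of
  \<open>R ^ N - 1 / R ^ N\<close> on the right are positive for \<open>R > 1\<close>, so their
  quotient supplies the factor \<open>P\<close>.\<close>

lemma sum_sin_over_ngon_square:
  assumes "0 < N" "0 < a" "2 * a < C"
  obtains P where "0 < P"
    "(\<Sum>j\<in>{1..N}. sin (ngon_angle N j + \<theta>) / (C - 2 * a * cos (ngon_angle N j + \<theta>))\<^sup>2)
       = P * sin (real N * \<theta>)"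
proof -
  define c where "c = C / a"
  have c: "2 < c" using assms by (simp add: c_def field_simps)
  define s where "s = sqrt (c\<^sup>2 - 4)"
  have "0 < c\<^sup>2 - 4" using power_strict_mono[OF c, of 2] by simp
  then have s: "0 < s" "s * s = c * c - 4" by (auto simp: s_def power2_eq_square)
  \<comment> \<open>the larger root of \<open>R + 1 / R = C / a\<close>\<close>
  define R where "R = (c + s) / 2"
  have R: "1 < R" using s(1) c by (simp add: R_def)
  have "R * R - c * R + 1 = 0"
    using s(2) by (simp add: R_def field_simps)
  then have Rc: "R + 1 / R = c" using R by (simp add: field_simps)
  let ?f = "\<lambda>j. ngon_angle N j + \<theta>"
  let ?n = "real N * \<theta>"
  have pos: "0 < x + 1 / x - 2 * cos y" if "1 < x" for x y :: real
    using add_inverse_gt_two[OF that] cos_le_one[of y] by linarith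
  have RN: "1 < R ^ N" using R assms by (simp add: one_less_power)
  let ?Q = "R ^ N + 1 / R ^ N - 2 * cos ?n"
  let ?g = "\<lambda>R. real N * (sin ?n / (R ^ N + 1 / R ^ N - 2 * cos ?n))"
  let ?s = "\<lambda>R. \<Sum>j\<in>{1..N}. sin (?f j) / (R + 1 / R - 2 * cos (?f j))"
  let ?D = "\<Sum>j\<in>{1..N}. sin (?f j) / (c - 2 * cos (?f j))\<^sup>2"
  have d: "((\<lambda>R. R + 1 / R - 2 * y) has_real_derivative 1 - 1 / R\<^sup>2) (at R)" for y
    using R by (auto intro!: derivative_eq_intros simp: power2_eq_square)
  have quot: "(0 * E - s * (1 - y)) / (E * E) = - (1 - y) * (s / E\<^sup>2)" for E s y :: real
    by (simp add: power2_eq_square algebra_simps diff_divide_distrib)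
  \<comment> \<open>The factor \<open>1 - 1 / R\<^sup>2\<close> is the same for every
    \<open>j\<close> and therefore leaves the sum.\<close>
  have "((\<lambda>R. sin (?f j) / (R + 1 / R - 2 * cos (?f j))) has_real_derivative
      - (1 - 1 / R\<^sup>2) * (sin (?f j) / (c - 2 * cos (?f j))\<^sup>2)) (at R)" for j
    by (rule DERIV_cong[OF DERIV_divide[OF DERIV_const d]])
       (unfold quot Rc, use pos[OF R, of "?f j"] Rc in simp_all)
  then have d1: "(?s has_real_derivative - (1 - 1 / R\<^sup>2) * ?D) (at R)"
    unfolding sum_distrib_left by (rule DERIV_sum)
  have dN: "((\<lambda>R. R ^ N + 1 / R ^ N - 2 * y) has_real_derivative real N * (R ^ N - 1 / R ^ N) / R) (at R)" for y
  proof -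
    have p: "((\<lambda>R. R ^ N) has_real_derivative real N * R ^ N / R) (at R)"
      by (rule DERIV_cong[OF DERIV_pow]) (use R in \<open>cases N, auto\<close>)
    have q: "((\<lambda>R. 1 / R ^ N) has_real_derivative - (real N * (1 / R ^ N) / R)) (at R)"
      by (rule DERIV_cong[OF DERIV_divide[OF DERIV_const p]]) (use R in auto)
    show ?thesis
      by (rule DERIV_cong[OF DERIV_diff[OF DERIV_add[OF p q] DERIV_const]])
        (simp add: right_diff_distrib diff_divide_distrib)
  qed
  have d2: "(?g has_real_derivative - (real N * real N * (R ^ N - 1 / R ^ N) / (R * ?Q\<^sup>2)) * sin ?n) (at R)"
    by (rule DERIV_cong[OF DERIV_cmult[OF DERIV_divide[OF DERIV_const dN]]])
       (use pos[OF RN, of ?n] R in \<open>auto simp: power2_eq_square\<close>)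
  \<comment> \<open>The closed form is available only for \<open>R > 1\<close>; an open
    neighbourhood of the point is enough to identify the two derivatives.\<close>
  have "(?s has_real_derivative - (real N * real N * (R ^ N - 1 / R ^ N) / (R * ?Q\<^sup>2)) * sin ?n) (at R)"
    by (rule has_field_derivative_transform_within_open[OF d2, of "{1<..}"])
       (use R sum_sin_over_ngon[OF assms(1)] in auto)
  from DERIV_unique[OF d1 this]
  have e: "(1 - 1 / R\<^sup>2) * ?D = (real N * real N * (R ^ N - 1 / R ^ N) / (R * ?Q\<^sup>2)) * sin ?n"
    by (simp only: mult_minus_left neg_equal_iff_equal)
  have R2: "0 < 1 - 1 / R\<^sup>2" "0 < R ^ N - 1 / R ^ N"
    using R RN by (auto simp: field_simps power2_eq_square less_1_mult)
  have "?D = (1 - 1 / R\<^sup>2) * ?D / (1 - 1 / R\<^sup>2)"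
    by (rule nonzero_mult_div_cancel_left[OF less_imp_neq[OF R2(1), symmetric], symmetric])
  then have D: "?D = (real N * real N * (R ^ N - 1 / R ^ N) / (R * ?Q\<^sup>2)) / (1 - 1 / R\<^sup>2) * sin ?n"
    unfolding e by (simp only: times_divide_eq_left)
  have "C - 2 * a * cos (?f j) = a * (c - 2 * cos (?f j))" for j
    using assms by (simp add: c_def field_simps)
  then have "(\<Sum>j\<in>{1..N}. sin (?f j) / (C - 2 * a * cos (?f j))\<^sup>2) = ?D / a\<^sup>2"
    by (simp add: power_mult_distrib sum_divide_distrib mult.commute)
  with D show ?thesis
    using R R2 assms pos[OF RN, of ?n]
    by (intro that[of "(real N * real N * (R ^ N - 1 / R ^ N) / (R * ?Q\<^sup>2)) / (1 - 1 / R\<^sup>2) / a\<^sup>2"]) auto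
qed

section \<open>The power -3/2 as a limit of primitives\<close>

lemma DERIV_inverse_square_primitive:
  fixes D u :: real
  assumes "0 < D"
  shows "((\<lambda>u. u / (2 * D * (D + u\<^sup>2)) + arctan (u / sqrt D) / (2 * D powr (3/2)))
    has_real_derivative 1 / (D + u\<^sup>2)\<^sup>2) (at u)"
proof -
  have pos: "0 < D + u\<^sup>2" using assms by (simp add: add_pos_nonneg)
  have pw: "D powr (3/2) = D * sqrt D"
    using assms powr_add[of D 1 "1/2"] by (simp add: powr_half_sqrt)
  have 1: "((\<lambda>u. u / (2 * D * (D + u\<^sup>2))) has_real_derivative (D - u\<^sup>2) / (2 * D * (D + u\<^sup>2)\<^sup>2)) (at u)"
  proof (rule DERIV_cong[OF DERIV_divide[OF DERIV_ident]])
    show "((\<lambda>u. 2 * D * (D + u\<^sup>2)) has_real_derivative 2 * D * (2 * u)) (at u)"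
      by (auto intro!: derivative_eq_intros)
    have "(1 * (2 * D * (D + u\<^sup>2)) - u * (2 * D * (2 * u))) / (2 * D * (D + u\<^sup>2) * (2 * D * (D + u\<^sup>2)))
        = (2 * D) * (D - u\<^sup>2) / ((2 * D) * (2 * D * (D + u\<^sup>2)\<^sup>2))"
      by (simp add: algebra_simps power2_eq_square)
    also have "\<dots> = (D - u\<^sup>2) / (2 * D * (D + u\<^sup>2)\<^sup>2)"
      using assms by (simp only: mult_divide_mult_cancel_left)
    finally show "(1 * (2 * D * (D + u\<^sup>2)) - u * (2 * D * (2 * u))) / (2 * D * (D + u\<^sup>2) * (2 * D * (D + u\<^sup>2)))
        = (D - u\<^sup>2) / (2 * D * (D + u\<^sup>2)\<^sup>2)" .
  qed (use assms pos in auto)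
  have 2: "((\<lambda>u. arctan (u / sqrt D) / (2 * D powr (3/2))) has_real_derivative 1 / (2 * D * (D + u\<^sup>2))) (at u)"
  proof (rule DERIV_cong[OF DERIV_cdivide[OF DERIV_chain2[OF DERIV_arctan DERIV_cdivide[OF DERIV_ident]]]])
    have "inverse (1 + (u / sqrt D)\<^sup>2) = D / (D + u\<^sup>2)"
      using assms pos by (simp add: power_divide field_simps)
    then have "inverse (1 + (u / sqrt D)\<^sup>2) * (1 / sqrt D) / (2 * D powr (3/2))
        = D / (D + u\<^sup>2) / (2 * D * (sqrt D * sqrt D))"
      by (simp add: pw)
    also have "sqrt D * sqrt D = D" using assms by simp
    finally show "inverse (1 + (u / sqrt D)\<^sup>2) * (1 / sqrt D) / (2 * D powr (3/2)) = 1 / (2 * D * (D + u\<^sup>2))"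
      using assms by simp
  qed
  show ?thesis
  proof (rule DERIV_cong[OF DERIV_add[OF 1 2]])
    \<comment> \<open>Over the common denominator the numerators \<open>D - u\<^sup>2\<close> and
      \<open>D + u\<^sup>2\<close> add up to the constant \<open>2 * D\<close>; the coefficient of
      the arctangent is chosen for this.\<close>
    have "(D - u\<^sup>2) / (2 * D * (D + u\<^sup>2)\<^sup>2) + 1 / (2 * D * (D + u\<^sup>2))
        = (D - u\<^sup>2) / (2 * D * (D + u\<^sup>2)\<^sup>2) + (D + u\<^sup>2) / (2 * D * (D + u\<^sup>2)\<^sup>2)"
      using pos by (simp add: power2_eq_square)
    also have "\<dots> = (2 * D) / (2 * D * (D + u\<^sup>2)\<^sup>2)"
      by (simp flip: add_divide_distrib)
    finally show "(D - u\<^sup>2) / (2 * D * (D + u\<^sup>2)\<^sup>2) + 1 / (2 * D * (D + u\<^sup>2)) = 1 / (D + u\<^sup>2)\<^sup>2"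
      using assms by simp
  qed
qed

text \<open>The rational part dies out and the arctangent tends to \<open>pi / 2\<close>. As the
  primitive vanishes at 0, its limit plays the part of the improper integral, and no integration
  theory is required.\<close>

lemma inverse_square_primitive_limit:
  fixes D :: real
  assumes "0 < D"
  shows "((\<lambda>u. u / (2 * D * (D + u\<^sup>2)) + arctan (u / sqrt D) / (2 * D powr (3/2)))
    \<longlongrightarrow> pi / 4 * (1 / D powr (3/2))) at_top"
proof -
  have "filterlim (\<lambda>u. u / sqrt D) at_top at_top"
    using assms by real_asymp
  then have "((\<lambda>u. arctan (u / sqrt D)) \<longlongrightarrow> pi / 2) at_top"
    by (rule filterlim_compose[OF tendsto_arctan_at_top])
  moreover have "((\<lambda>u. u / (2 * D * (D + u\<^sup>2))) \<longlongrightarrow> 0) at_top"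
    using assms by real_asymp
  ultimately have "((\<lambda>u. u / (2 * D * (D + u\<^sup>2)) + arctan (u / sqrt D) / (2 * D powr (3/2)))
    \<longlongrightarrow> 0 + pi / 2 / (2 * D powr (3/2))) at_top"
    using assms by (intro tendsto_add tendsto_divide tendsto_const) auto
  then show ?thesis by simp
qed

text \<open>\<open>H\<close> starts at 0, tends to \<open>pi / 4 * S\<close>, and has derivative a
  positive multiple of \<open>sin (N\<theta>)\<close>. So it is identically 0 if the sine vanishes,
  and otherwise strictly monotone, which keeps its limit away from 0.\<close>

lemma sum_sin_over_ngon_powr_eq_0_iff:
  assumes "0 < N" "0 < a" "2 * a < C"
  shows "(\<Sum>j\<in>{1..N}. sin (ngon_angle N j + \<theta>) / (C - 2 * a * cos (ngon_angle N j + \<theta>)) powr (3/2)) = 0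
    \<longleftrightarrow> sin (real N * \<theta>) = 0"
proof -
  define S where "S = (\<Sum>j\<in>{1..N}. sin (ngon_angle N j + \<theta>) / (C - 2 * a * cos (ngon_angle N j + \<theta>)) powr (3/2))"
  define D where "D j = C - 2 * a * cos (ngon_angle N j + \<theta>)" for j
  define G where "G j u = u / (2 * D j * (D j + u\<^sup>2)) + arctan (u / sqrt (D j)) / (2 * D j powr (3/2))" for j u
  define H where "H u = (\<Sum>j\<in>{1..N}. sin (ngon_angle N j + \<theta>) * G j u)" for u
  have D: "0 < D j" for j
  proof -
    have "2 * a * cos (ngon_angle N j + \<theta>) \<le> 2 * a * 1" using assms by (intro mult_left_mono) auto
    then show ?thesis using assms(3) unfolding D_def by linarith
  qed
  have "(H has_real_derivative (\<Sum>j\<in>{1..N}. sin (ngon_angle N j + \<theta>) * (1 / (D j + u\<^sup>2)\<^sup>2))) (at u)" for u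
    unfolding H_def G_def
    by (intro DERIV_sum DERIV_cmult DERIV_inverse_square_primitive D)
  moreover have "\<exists>P>0. (\<Sum>j\<in>{1..N}. sin (ngon_angle N j + \<theta>) * (1 / (D j + u\<^sup>2)\<^sup>2)) = P * sin (real N * \<theta>)" for u
  proof -
    have "2 * a < C + u\<^sup>2" using assms(3) zero_le_power2[of u] by linarith
    from sum_sin_over_ngon_square[OF assms(1,2) this, of \<theta>] show ?thesis
      by (auto simp: D_def algebra_simps)
  qed
  ultimately have "\<exists>P>0. (H has_real_derivative P * sin (real N * \<theta>)) (at u)" for u
    by metis
  then obtain P where P: "\<And>u. 0 < P u" "\<And>u. (H has_real_derivative P u * sin (real N * \<theta>)) (at u)"
    by metis
  have "(H \<longlongrightarrow> (\<Sum>j\<in>{1..N}. sin (ngon_angle N j + \<theta>) * (pi / 4 * (1 / D j powr (3/2))))) at_top"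
    unfolding H_def G_def
    by (intro tendsto_sum tendsto_mult_left inverse_square_primitive_limit D)
  also have "(\<Sum>j\<in>{1..N}. sin (ngon_angle N j + \<theta>) * (pi / 4 * (1 / D j powr (3/2)))) = pi / 4 * S"
    by (simp add: S_def D_def sum_distrib_left mult.commute)
  finally have lim: "(H \<longlongrightarrow> pi / 4 * S) at_top" .
  have H0: "H 0 = 0" by (simp add: H_def G_def)
  show ?thesis
  proof (cases "sin (real N * \<theta>) = 0")
    case True
    then have "H u = 0" for u
      using DERIV_isconst_all[of H u 0] P(2) H0 by simp
    then have "H = (\<lambda>_. 0)" by auto
    with lim have "pi / 4 * S = 0" by (simp add: tendsto_const_iff)
    with True show ?thesis by (simp add: S_def)
  next
    case False
    \<comment> \<open>Multiplying by the sine makes the function increasing whichever sign the sine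
      has.\<close>
    let ?K = "\<lambda>u. H u * sin (real N * \<theta>)"
    have "(?K has_real_derivative P u * (sin (real N * \<theta>))\<^sup>2) (at u)" for u
      using DERIV_cmult_right[OF P(2)[of u], of "sin (real N * \<theta>)"] by (simp add: power2_eq_square mult.assoc)
    moreover have "0 < P u * (sin (real N * \<theta>))\<^sup>2" for u
      using P(1) False by simp
    ultimately have mono: "?K u < ?K v" if "u < v" for u v
      using that by (meson DERIV_pos_imp_increasing)
    \<comment> \<open>A limit preserves only weak inequalities, so the strict gain is secured on the
      way from 0 to 1.\<close>
    have "?K 1 \<le> pi / 4 * S * sin (real N * \<theta>)"
    proof (rule tendsto_lowerbound[OF tendsto_mult_right[OF lim]])
      show "\<forall>\<^sub>F u in at_top. ?K 1 \<le> ?K u"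
        using eventually_gt_at_top[of 1] by eventually_elim (use mono in \<open>auto intro: less_imp_le\<close>)
    qed auto
    moreover have "?K 0 < ?K 1" by (rule mono) simp
    ultimately have "S \<noteq> 0" using H0 by auto
    with False show ?thesis by (simp add: S_def)
  qed
qed

section \<open>Forces between the layers and within each polygon\<close>

definition cross_sum :: "(real \<Rightarrow> real) \<Rightarrow> nat \<Rightarrow> real \<Rightarrow> real \<Rightarrow> real \<Rightarrow> real" where
  "cross_sum f N a h \<theta> = (\<Sum>j\<in>{1..N}. f (ngon_angle N j + \<theta>) /
     (1 + a\<^sup>2 - 2 * a * cos (ngon_angle N j + \<theta>) + h\<^sup>2) powr (3/2))"

lemma norm_Pair_cube: "norm (z :: complex, t :: real) ^ 3 = ((norm z)\<^sup>2 + t\<^sup>2) powr (3/2)"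
proof -
  have "norm (z, t) ^ 3 = (((norm z)\<^sup>2 + t\<^sup>2) powr (1/2)) ^ 3"
    by (simp add: norm_Pair powr_half_sqrt)
  also have "\<dots> = ((norm z)\<^sup>2 + t\<^sup>2) powr (3/2)"
    by (cases "(norm z)\<^sup>2 + t\<^sup>2 = 0") (simp_all add: powr_power)
  finally show ?thesis .
qed

text \<open>A force seen from a given body depends only on a ratio of positions, and these ratios
  run through the same set for every \<open>k\<close>. The second form has the summation index in
  the denominator, hence an inversion of the roots before the rotation.\<close>

lemma sum_ngon_ratio:
  assumes "k \<in> {1..N}"
  shows "(\<Sum>j\<in>{1..N}. f (ngon_root N j * cis \<theta> / ngon_root N k)) = (\<Sum>j\<in>{1..N}. f (cis (ngon_angle N j + \<theta>)))"
    and "(\<Sum>j\<in>{1..N}. f (ngon_root N k * cis \<theta> / ngon_root N j)) = (\<Sum>j\<in>{1..N}. f (cis (ngon_angle N j + \<theta>)))"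
proof -
  have N: "0 < N" using assms by auto
  note k = ngon_root_power[OF N assms]
  let ?r = "ngon_root N"
  have eq: "(\<Sum>j\<in>{1..N}. f (?r j * cis \<theta>)) = (\<Sum>j\<in>{1..N}. f (cis (ngon_angle N j + \<theta>)))"
    by (simp add: ngon_root_def cis_mult)
  have "(\<Sum>j\<in>{1..N}. f (?r j * cis \<theta> / ?r k)) = (\<Sum>j\<in>{1..N}. f (?r j * inverse (?r k) * cis \<theta>))"
    by (simp add: divide_inverse mult_ac)
  also have "\<dots> = (\<Sum>j\<in>{1..N}. f (?r j * cis \<theta>))"
    by (rule sum_ngon_root_mult[OF N]) (simp add: k power_inverse)
  finally show "(\<Sum>j\<in>{1..N}. f (?r j * cis \<theta> / ?r k)) = (\<Sum>j\<in>{1..N}. f (cis (ngon_angle N j + \<theta>)))"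
    unfolding eq .
  have "(\<Sum>j\<in>{1..N}. f (?r k * cis \<theta> / ?r j)) = (\<Sum>j\<in>{1..N}. f (inverse (?r j) * ?r k * cis \<theta>))"
    by (simp add: divide_inverse mult_ac)
  also have "\<dots> = (\<Sum>j\<in>{1..N}. f (?r j * ?r k * cis \<theta>))"
    by (rule sum_ngon_root_inverse[OF N])
  also have "\<dots> = (\<Sum>j\<in>{1..N}. f (?r j * cis \<theta>))"
    by (rule sum_ngon_root_mult[OF N k])
  finally show "(\<Sum>j\<in>{1..N}. f (?r k * cis \<theta> / ?r j)) = (\<Sum>j\<in>{1..N}. f (cis (ngon_angle N j + \<theta>)))"
    unfolding eq .
qed

lemma norm_twist_cube:
  "norm (of_real a * cis \<phi> - 1, h) ^ 3 = (1 + a\<^sup>2 - 2 * a * cos \<phi> + h\<^sup>2) powr (3/2)"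
proof -
  have "(norm (of_real a * cis \<phi> - 1))\<^sup>2 = 1 + a\<^sup>2 * ((cos \<phi>)\<^sup>2 + (sin \<phi>)\<^sup>2) - 2 * a * cos \<phi>"
    unfolding cmod_power2 by (simp add: algebra_simps power2_eq_square del: sin_cos_squared_add sin_cos_squared_add2 sin_cos_squared_add3)
  then show ?thesis by (simp add: norm_Pair_cube)
qed

lemma norm_Pair_cmult: "norm u = 1 \<Longrightarrow> norm (u * z :: complex, t :: real) = norm (z, t)"
  by (simp add: norm_Pair norm_mult)

text \<open>Dividing by the position of body \<open>k\<close> leaves a function of the ratio
  \<open>z\<close> alone. In that frame the real part is radial and the imaginary part tangential,
  so the weights 1, cos and sin of \<open>cross_sum\<close> appear.\<close>

lemma ngon_cross_force_lower:
  assumes "k \<in> {1..N}"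
  shows "(\<Sum>j\<in>{1..N}. (1 / norm ((of_real a * ngon_root N j * cis \<theta>, h) - (ngon_root N k, 0)) ^ 3) *\<^sub>R
      ((of_real a * ngon_root N j * cis \<theta>, h) - (ngon_root N k, 0)))
    = (ngon_root N k * Complex (a * cross_sum cos N a h \<theta> - cross_sum (\<lambda>_. 1) N a h \<theta>) (a * cross_sum sin N a h \<theta>),
       h * cross_sum (\<lambda>_. 1) N a h \<theta>)"
proof -
  let ?r = "ngon_root N"
  define f :: "complex \<Rightarrow> complex \<times> real" where "f z = (1 / norm (of_real a * z - 1, h) ^ 3) *\<^sub>R (of_real a * z - 1, h)" for z
  define g where "g z = (?r k * fst (f z), snd (f z))" for z
  have "(1 / norm ((of_real a * ?r j * cis \<theta>, h) - (?r k, 0)) ^ 3) *\<^sub>R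
      ((of_real a * ?r j * cis \<theta>, h) - (?r k, 0)) = g (?r j * cis \<theta> / ?r k)" for j
  proof -
    have *: "(of_real a * ?r j * cis \<theta>, h) - (?r k, 0) = (?r k * (of_real a * (?r j * cis \<theta> / ?r k) - 1), h)"
      by (simp add: right_diff_distrib)
    show ?thesis
      unfolding * norm_Pair_cmult[OF norm_ngon_root] by (simp add: g_def f_def)
  qed
  then have "(\<Sum>j\<in>{1..N}. (1 / norm ((of_real a * ?r j * cis \<theta>, h) - (?r k, 0)) ^ 3) *\<^sub>R
      ((of_real a * ?r j * cis \<theta>, h) - (?r k, 0))) = (\<Sum>j\<in>{1..N}. g (cis (ngon_angle N j + \<theta>)))"
    by (simp only: sum_ngon_ratio(1)[OF assms])
  also have "\<dots> = (?r k * (\<Sum>j\<in>{1..N}. fst (f (cis (ngon_angle N j + \<theta>)))), \<Sum>j\<in>{1..N}. snd (f (cis (ngon_angle N j + \<theta>))))"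
    by (simp add: g_def prod_eq_iff fst_sum snd_sum sum_distrib_left)
  also have "(\<Sum>j\<in>{1..N}. fst (f (cis (ngon_angle N j + \<theta>))))
      = Complex (a * cross_sum cos N a h \<theta> - cross_sum (\<lambda>_. 1) N a h \<theta>) (a * cross_sum sin N a h \<theta>)"
    by (simp add: f_def norm_twist_cube complex_eq_iff cross_sum_def sum_distrib_left diff_divide_distrib flip: sum_subtractf)
  also have "(\<Sum>j\<in>{1..N}. snd (f (cis (ngon_angle N j + \<theta>)))) = h * cross_sum (\<lambda>_. 1) N a h \<theta>"
    by (simp add: f_def norm_twist_cube cross_sum_def sum_distrib_left)
  finally show ?thesis .
qed

text \<open>The ratio \<open>z\<close> is again upper body over lower body, so that the distances
  are those of the preceding lemma. Seen from the upper body, the lower one lies in direction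
  \<open>cnj z\<close>; this reverses the sign of the sine sum.\<close>

lemma ngon_cross_force_upper:
  assumes "k \<in> {1..N}"
  shows "(\<Sum>j\<in>{1..N}. (1 / norm ((ngon_root N j, 0) - (of_real a * ngon_root N k * cis \<theta>, h)) ^ 3) *\<^sub>R
      ((ngon_root N j, 0) - (of_real a * ngon_root N k * cis \<theta>, h)))
    = (ngon_root N k * cis \<theta> * Complex (cross_sum cos N a h \<theta> - a * cross_sum (\<lambda>_. 1) N a h \<theta>) (- cross_sum sin N a h \<theta>),
       - h * cross_sum (\<lambda>_. 1) N a h \<theta>)"
proof -
  let ?r = "ngon_root N"
  define f :: "complex \<Rightarrow> complex \<times> real" where "f z = (1 / norm (of_real a * z - 1, h) ^ 3) *\<^sub>R (cnj z - of_real a, - h)" for z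
  define g where "g z = (?r k * cis \<theta> * fst (f z), snd (f z))" for z
  have "(1 / norm ((?r j, 0) - (of_real a * ?r k * cis \<theta>, h)) ^ 3) *\<^sub>R
      ((?r j, 0) - (of_real a * ?r k * cis \<theta>, h)) = g (?r k * cis \<theta> / ?r j)" for j
  proof -
    have *: "(of_real a * ?r k * cis \<theta>, h) - (?r j, 0) = (?r j * (of_real a * (?r k * cis \<theta> / ?r j) - 1), h)"
      by (simp add: right_diff_distrib)
    have "norm ((?r j, 0) - (of_real a * ?r k * cis \<theta>, h)) = norm (of_real a * (?r k * cis \<theta> / ?r j) - 1, h)"
      unfolding norm_minus_commute[of "(?r j, 0)"] * norm_Pair_cmult[OF norm_ngon_root] ..
    moreover have "(?r j, 0) - (of_real a * ?r k * cis \<theta>, h)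
        = (?r k * cis \<theta> * (cnj (?r k * cis \<theta> / ?r j) - of_real a), - h)"
      by (simp add: right_diff_distrib ngon_root_def cis_cnj cis_mult cis_divide)
    ultimately show ?thesis by (simp add: g_def f_def)
  qed
  then have "(\<Sum>j\<in>{1..N}. (1 / norm ((?r j, 0) - (of_real a * ?r k * cis \<theta>, h)) ^ 3) *\<^sub>R
      ((?r j, 0) - (of_real a * ?r k * cis \<theta>, h))) = (\<Sum>j\<in>{1..N}. g (cis (ngon_angle N j + \<theta>)))"
    by (simp only: sum_ngon_ratio(2)[OF assms])
  also have "\<dots> = (?r k * cis \<theta> * (\<Sum>j\<in>{1..N}. fst (f (cis (ngon_angle N j + \<theta>)))), \<Sum>j\<in>{1..N}. snd (f (cis (ngon_angle N j + \<theta>))))"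
    by (simp add: g_def prod_eq_iff fst_sum snd_sum sum_distrib_left)
  also have "(\<Sum>j\<in>{1..N}. fst (f (cis (ngon_angle N j + \<theta>))))
      = Complex (cross_sum cos N a h \<theta> - a * cross_sum (\<lambda>_. 1) N a h \<theta>) (- cross_sum sin N a h \<theta>)"
    by (simp add: f_def norm_twist_cube complex_eq_iff cross_sum_def sum_distrib_left diff_divide_distrib
        flip: sum_subtractf sum_negf)
  also have "(\<Sum>j\<in>{1..N}. snd (f (cis (ngon_angle N j + \<theta>)))) = - h * cross_sum (\<lambda>_. 1) N a h \<theta>"
    by (simp add: f_def norm_twist_cube cross_sum_def sum_distrib_left flip: sum_negf)
  finally show ?thesis .
qed

lemma ngon_self_force:
  assumes "k \<in> {1..N}"
  shows "(\<Sum>j\<in>{1..N} - {k}. (1 / norm (ngon_root N j - ngon_root N k) ^ 3) *\<^sub>R (ngon_root N j - ngon_root N k))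
    = - of_real (ngon_A N) * ngon_root N k"
proof -
  let ?r = "ngon_root N"
  define f where "f z = - ((1 - z) / of_real (norm (1 - z) ^ 3)) * ?r k" for z
  have "(1 / norm (?r j - ?r k) ^ 3) *\<^sub>R (?r j - ?r k) = f (?r j / ?r k)" for j
  proof -
    have *: "?r j - ?r k = - (1 - ?r j / ?r k) * ?r k"
      by (simp add: left_diff_distrib)
    show ?thesis
      unfolding * norm_mult norm_ngon_root norm_minus_cancel by (simp add: f_def scaleR_conv_of_real algebra_simps diff_divide_distrib)
  qed
  then have "(\<Sum>j\<in>{1..N} - {k}. (1 / norm (?r j - ?r k) ^ 3) *\<^sub>R (?r j - ?r k)) = (\<Sum>j\<in>{1..N - 1}. f (?r j))"
    using sum_ngon_root_delete[of N k f] assms by simp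
  also have "\<dots> = - of_real (ngon_A N) * ?r k"
    by (simp add: f_def of_real_ngon_A sum_negf sum_distrib_right)
  finally show ?thesis .
qed

section \<open>Center of mass and the balance equations\<close>

lemma sum_ngon_root_eq_0: "2 \<le> N \<Longrightarrow> (\<Sum>j\<in>{1..N}. ngon_root N j) = 0"
  using sum_ngon_root_pow[of 1 N] by simp

text \<open>The roots sum to zero, so both polygons are centered on the vertical axis. What remains
  is the mean of the heights 0 and \<open>h\<close> with weights 1 and \<open>b\<close>.\<close>

lemma center_of_mass_twisted_ngons:
  assumes "2 \<le> N" "0 < b" "0 < m"
  shows "center_of_mass ({1..N} <+> {1..N}) (twisted_ngons_mass b m) (twisted_ngons_pos N a h \<theta>)
    = (0, b * h / (1 + b))"
proof -
  let ?I = "{1..N} <+> {1..N}" and ?x = "twisted_ngons_pos N a h \<theta>" and ?\<mu> = "twisted_ngons_mass b m"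
  have M: "(\<Sum>j\<in>?I. ?\<mu> j) = real N * m * (1 + b)"
    by (simp add: sum.Plus twisted_ngons_mass_def algebra_simps)
  have "(\<Sum>j\<in>{1..N}. m *\<^sub>R (ngon_root N j, 0::real)) = 0"
    using sum_ngon_root_eq_0[OF assms(1)]
    by (simp add: prod_eq_iff fst_sum snd_sum flip: scaleR_sum_right)
  moreover have "(\<Sum>j\<in>{1..N}. (b * m) *\<^sub>R (of_real a * ngon_root N j * cis \<theta>, h)) = (0, real N * (b * m) * h)"
    using sum_ngon_root_eq_0[OF assms(1)]
    by (simp add: prod_eq_iff fst_sum snd_sum flip: scaleR_sum_right sum_distrib_left sum_distrib_right)
  ultimately have "(\<Sum>j\<in>?I. ?\<mu> j *\<^sub>R ?x j) = (0, real N * (b * m) * h)"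
    by (simp add: sum.Plus twisted_ngons_mass_def twisted_ngons_pos_def del: scaleR_Pair)
  moreover have "(real N * (b * m) * h) / (real N * m * (1 + b)) = ((real N * m) * (b * h)) / ((real N * m) * (1 + b))"
    by (simp add: mult_ac)
  moreover have "\<dots> = b * h / (1 + b)"
    using assms by (intro nonzero_mult_divide_mult_cancel_left) auto
  ultimately show ?thesis
    unfolding center_of_mass_def M by (simp only: scaleR_Pair real_scaleR_def mult_zero_right scaleR_zero_right
      mult.commute[of "inverse _"] divide_inverse[symmetric])
qed

lemma inj_on_twisted_ngons_pos:
  assumes "0 < N" "0 < a" "h \<noteq> 0 \<or> a \<noteq> 1"
  shows "inj_on (twisted_ngons_pos N a h \<theta>) ({1..N} <+> {1..N})"
proof (rule inj_onI)
  have inj: "ngon_root N j = ngon_root N k \<longleftrightarrow> j = k" if "j \<in> {1..N}" "k \<in> {1..N}" for j k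
    using bij_betw_ngon_root[OF assms(1)] that by (auto simp: bij_betw_def dest: inj_onD)
  \<comment> \<open>In the coplanar case the layers lie on circles of radii 1 and \<open>a\<close>,
    which differ.\<close>
  have ne: "ngon_root N j \<noteq> of_real a * ngon_root N k * cis \<theta>" if "h = 0" for j k
  proof
    assume "ngon_root N j = of_real a * ngon_root N k * cis \<theta>"
    then have "norm (ngon_root N j) = norm (of_real a * ngon_root N k * cis \<theta>)" by simp
    then show False using assms that by (simp add: norm_mult)
  qed
  fix p q
  assume "p \<in> {1..N} <+> {1..N}" "q \<in> {1..N} <+> {1..N}"
    and "twisted_ngons_pos N a h \<theta> p = twisted_ngons_pos N a h \<theta> q"
  then show "p = q"
    using assms inj ne by (auto simp: twisted_ngons_pos_def dest: sym)
qed

lemma twisted_ngons_force: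
  fixes N :: nat and a b m h \<theta> :: real
  defines "F \<equiv> \<lambda>k. \<Sum>j\<in>({1..N} <+> {1..N}) - {k}.
    (twisted_ngons_mass b m j * twisted_ngons_mass b m k
      / norm (twisted_ngons_pos N a h \<theta> j - twisted_ngons_pos N a h \<theta> k) ^ 3) *\<^sub>R
    (twisted_ngons_pos N a h \<theta> j - twisted_ngons_pos N a h \<theta> k)"
  defines "C0 \<equiv> cross_sum (\<lambda>_. 1) N a h \<theta>" and "C1 \<equiv> cross_sum cos N a h \<theta>" and "S \<equiv> cross_sum sin N a h \<theta>"
  assumes k: "k \<in> {1..N}" and a: "0 < a"
  shows "F (Inl k) = (m * m) *\<^sub>R (ngon_root N k * Complex (b * (a * C1 - C0) - ngon_A N) (b * a * S), b * h * C0)" (is ?L)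
    and "F (Inr k) = (b * m * m) *\<^sub>R
      (ngon_root N k * cis \<theta> * Complex (C1 - a * C0 - b * ngon_A N / a\<^sup>2) (- S), - h * C0)" (is ?U)
proof -
  let ?r = "ngon_root N" and ?x = "twisted_ngons_pos N a h \<theta>"
  have scale: "(\<Sum>j\<in>I. (c / norm (f j) ^ 3) *\<^sub>R f j) = c *\<^sub>R (\<Sum>j\<in>I. (1 / norm (f j) ^ 3) *\<^sub>R f j)"
    for c :: real and I :: "nat set" and f :: "nat \<Rightarrow> complex \<times> real"
    by (simp add: scaleR_sum_right)
  have self: "(\<Sum>j\<in>{1..N} - {k}. (1 / norm (?x (Inl j) - ?x (Inl k)) ^ 3) *\<^sub>R (?x (Inl j) - ?x (Inl k)))
      = (- of_real (ngon_A N) * ?r k, 0)"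
    using ngon_self_force[OF k] by (simp add: twisted_ngons_pos_def prod_eq_iff fst_sum snd_sum norm_Pair)
  \<comment> \<open>Scaling lengths by \<open>a\<close> divides an inverse-square force by
    \<open>a\<^sup>2\<close>.\<close>
  have "(1 / norm (?x (Inr j) - ?x (Inr k)) ^ 3) *\<^sub>R (?x (Inr j) - ?x (Inr k))
      = (of_real (1 / a\<^sup>2) * cis \<theta> * ((1 / norm (?r j - ?r k) ^ 3) *\<^sub>R (?r j - ?r k)), 0)" for j
  proof -
    have *: "of_real a * ?r j * cis \<theta> - of_real a * ?r k * cis \<theta> = of_real a * cis \<theta> * (?r j - ?r k)"
      by (simp add: algebra_simps)
    have "norm (of_real a * cis \<theta> * (?r j - ?r k)) = a * norm (?r j - ?r k)"
      using a by (simp add: norm_mult)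
    then show ?thesis
      using a by (simp add: twisted_ngons_pos_def * norm_Pair scaleR_conv_of_real power_mult_distrib
          power2_eq_square power3_eq_cube)
  qed
  then have self': "(\<Sum>j\<in>{1..N} - {k}. (1 / norm (?x (Inr j) - ?x (Inr k)) ^ 3) *\<^sub>R (?x (Inr j) - ?x (Inr k)))
      = (of_real (1 / a\<^sup>2) * cis \<theta> * (- of_real (ngon_A N) * ?r k), 0)"
    by (simp only: prod_eq_iff fst_sum snd_sum fst_conv snd_conv sum_distrib_left[symmetric]
        sum.neutral_const ngon_self_force[OF k])
  have cross: "(\<Sum>j\<in>{1..N}. (1 / norm (?x (Inr j) - ?x (Inl k)) ^ 3) *\<^sub>R (?x (Inr j) - ?x (Inl k)))
      = (?r k * Complex (a * C1 - C0) (a * S), h * C0)"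
    unfolding twisted_ngons_pos_def sum.case C0_def C1_def S_def by (rule ngon_cross_force_lower[OF k])
  have cross': "(\<Sum>j\<in>{1..N}. (1 / norm (?x (Inl j) - ?x (Inr k)) ^ 3) *\<^sub>R (?x (Inl j) - ?x (Inr k)))
      = (?r k * cis \<theta> * Complex (C1 - a * C0) (- S), - h * C0)"
    unfolding twisted_ngons_pos_def sum.case C0_def C1_def S_def by (rule ngon_cross_force_upper[OF k])
  have Il: "({1..N} <+> {1..N}) - {Inl k} = ({1..N} - {k}) <+> {1..N}"
    and Ir: "({1..N} <+> {1..N}) - {Inr k} = {1..N} <+> ({1..N} - {k})" by auto
  have "F (Inl k) = (m * m) *\<^sub>R (- of_real (ngon_A N) * ?r k, 0)
     + (b * m * m) *\<^sub>R (?r k * Complex (a * C1 - C0) (a * S), h * C0)"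
    unfolding F_def Il
    by (simp only: sum.Plus finite_atLeastAtMost finite_Diff o_def twisted_ngons_mass_def sum.case
        scale[of "m * m"] scale[of "b * m * m"] self cross)
  also have "\<dots> = (m * m) *\<^sub>R (?r k * Complex (b * (a * C1 - C0) - ngon_A N) (b * a * S), b * h * C0)"
    by (simp add: complex_eq_iff algebra_simps)
  finally show ?L .
  have "F (Inr k) = (b * m * m) *\<^sub>R (?r k * cis \<theta> * Complex (C1 - a * C0) (- S), - h * C0)
     + (b * m * b * m) *\<^sub>R (of_real (1 / a\<^sup>2) * cis \<theta> * (- of_real (ngon_A N) * ?r k), 0)"
    unfolding F_def Ir
    by (simp only: sum.Plus finite_atLeastAtMost finite_Diff o_def twisted_ngons_mass_def sum.case
        mult.left_commute[of m b m] mult.assoc scale[of "b * (m * m)"] scale[of "b * (b * (m * m))"] self' cross')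
  also have "\<dots> = (b * m * m) *\<^sub>R (?r k * cis \<theta> * Complex (C1 - a * C0 - b * ngon_A N / a\<^sup>2) (- S), - h * C0)"
    by (simp add: complex_eq_iff algebra_simps add_divide_distrib diff_divide_distrib)
  finally show ?U .
qed

text \<open>Splits the equation of one body of mass \<open>p\<close> into radial, tangential and
  vertical parts, after cancelling \<open>p\<close> and the direction \<open>z\<close>.\<close>

lemma scaled_pair_eq_iff:
  fixes z :: complex and p m :: real
  assumes "z \<noteq> 0" "p \<noteq> 0" "m \<noteq> 0"
  shows "(p * m) *\<^sub>R (z * Complex X Y, H) = - (l * p) *\<^sub>R (of_real r * z, t)
    \<longleftrightarrow> m * X = - l * r \<and> Y = 0 \<and> m * H = - l * t"
proof -
  have "(p * m) *\<^sub>R (z * Complex X Y) = - (l * p) *\<^sub>R (of_real r * z)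
      \<longleftrightarrow> of_real p * z * Complex (m * X + l * r) (m * Y) = 0"
    by (simp add: complex_eq_iff eq_neg_iff_add_eq_0 algebra_simps)
  also have "\<dots> \<longleftrightarrow> m * X = - l * r \<and> Y = 0"
    using assms by (simp add: Complex_eq_0 eq_neg_iff_add_eq_0)
  finally have 1: "(p * m) *\<^sub>R (z * Complex X Y) = - (l * p) *\<^sub>R (of_real r * z) \<longleftrightarrow> m * X = - l * r \<and> Y = 0" .
  have "(p * m) *\<^sub>R H = - (l * p) *\<^sub>R t \<longleftrightarrow> p * (m * H) = p * (- l * t)"
    by (simp add: mult_ac)
  also have "\<dots> \<longleftrightarrow> m * H = - l * t"
    by (rule mult_left_cancel[OF assms(2)])
  finally have 2: "(p * m) *\<^sub>R H = - (l * p) *\<^sub>R t \<longleftrightarrow> m * H = - l * t" .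
  show ?thesis unfolding scaleR_Pair prod.inject 1 2 by auto
qed

text \<open>The index \<open>k\<close> cancels from all equations, leaving one system per layer. The
  tangential equations of both layers reduce to \<open>S = 0\<close>, and their vertical equations
  coincide.\<close>

lemma twisted_ngons_central_iff:
  fixes N :: nat and a b m h \<theta> :: real
  defines "C0 \<equiv> cross_sum (\<lambda>_. 1) N a h \<theta>" and "C1 \<equiv> cross_sum cos N a h \<theta>" and "S \<equiv> cross_sum sin N a h \<theta>"
  assumes N: "2 \<le> N" and a: "0 < a" and b: "0 < b" and m: "0 < m" and "h \<noteq> 0 \<or> a \<noteq> 1"
  shows "twisted_ngons_central N a b m h \<theta> \<longleftrightarrow>
    S = 0 \<and> (\<exists>l. ngon_A N + b * (C0 - a * C1) = l \<and> b * ngon_A N / a\<^sup>2 + a * C0 - C1 = a * l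
       \<and> (h = 0 \<or> (1 + b) * C0 = l))" (is "_ \<longleftrightarrow> ?R")
proof -
  let ?I = "{1..N} <+> {1..N}" and ?x = "twisted_ngons_pos N a h \<theta>" and ?\<mu> = "twisted_ngons_mass b m"
  let ?c = "(0 :: complex, b * h / (1 + b))"
  define F where "F k = (\<Sum>j\<in>?I - {k}. (?\<mu> j * ?\<mu> k / norm (?x j - ?x k) ^ 3) *\<^sub>R (?x j - ?x k))" for k
  have bne: "1 + b \<noteq> 0" using b by simp
  have lower: "F (Inl k) = - (l * ?\<mu> (Inl k)) *\<^sub>R (?x (Inl k) - ?c)
      \<longleftrightarrow> m * (b * (a * C1 - C0) - ngon_A N) = - l \<and> S = 0 \<and> (h = 0 \<or> m * (1 + b) * C0 = l)"
    if k: "k \<in> {1..N}" for k l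
  proof -
    have f: "F (Inl k) = (m * m) *\<^sub>R (ngon_root N k * Complex (b * (a * C1 - C0) - ngon_A N) (b * a * S), b * h * C0)"
      unfolding F_def C0_def C1_def S_def by (rule twisted_ngons_force(1)[OF k a])
    have g: "- (l * ?\<mu> (Inl k)) *\<^sub>R (?x (Inl k) - ?c)
        = - (l * m) *\<^sub>R (of_real 1 * ngon_root N k, - (b * h / (1 + b)))"
      by (simp add: twisted_ngons_pos_def twisted_ngons_mass_def)
    \<comment> \<open>Relative to the center of mass the lower layer has height
      \<open>- (b * h / (1 + b))\<close>. The common factor \<open>b * h\<close> either vanishes or
      cancels.\<close>
    have "m * (b * h * C0) = - l * - (b * h / (1 + b)) \<longleftrightarrow> (b * h) * (m * (1 + b) * C0) = (b * h) * l"
      using bne by (simp add: field_simps)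
    then have v: "m * (b * h * C0) = - l * - (b * h / (1 + b)) \<longleftrightarrow> h = 0 \<or> m * (1 + b) * C0 = l"
      using b by simp
    show ?thesis
      unfolding f g scaled_pair_eq_iff[OF ngon_root_nonzero less_imp_neq[OF m, symmetric] less_imp_neq[OF m, symmetric]] v
      using a b by simp
  qed
  have upper: "F (Inr k) = - (l * ?\<mu> (Inr k)) *\<^sub>R (?x (Inr k) - ?c)
      \<longleftrightarrow> m * (C1 - a * C0 - b * ngon_A N / a\<^sup>2) = - l * a \<and> S = 0 \<and> (h = 0 \<or> m * (1 + b) * C0 = l)"
    if k: "k \<in> {1..N}" for k l
  proof -
    have f: "F (Inr k) = (b * m * m) *\<^sub>R
      (ngon_root N k * cis \<theta> * Complex (C1 - a * C0 - b * ngon_A N / a\<^sup>2) (- S), - h * C0)"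
      unfolding F_def C0_def C1_def S_def by (rule twisted_ngons_force(2)[OF k a])
    have "h - b * h / (1 + b) = h / (1 + b)" using bne by (simp add: field_simps)
    then have g: "- (l * ?\<mu> (Inr k)) *\<^sub>R (?x (Inr k) - ?c)
        = - (l * (b * m)) *\<^sub>R (of_real a * (ngon_root N k * cis \<theta>), h / (1 + b))"
      by (simp add: twisted_ngons_pos_def twisted_ngons_mass_def mult_ac)
    have "m * (- h * C0) = - l * (h / (1 + b)) \<longleftrightarrow> h * (m * (1 + b) * C0) = h * l"
      using bne by (simp add: field_simps)
    then have v: "m * (- h * C0) = - l * (h / (1 + b)) \<longleftrightarrow> h = 0 \<or> m * (1 + b) * C0 = l"
      by simp
    have ne: "ngon_root N k * cis \<theta> \<noteq> 0" "b * m \<noteq> 0" "m \<noteq> 0" using b m by simp_all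
    show ?thesis
      unfolding f g scaled_pair_eq_iff[OF ne] v by simp
  qed
  have "finite ?I" "?I \<noteq> {}" "\<forall>k\<in>?I. 0 < ?\<mu> k" "inj_on ?x ?I"
    using assms inj_on_twisted_ngons_pos[of N a h \<theta>] by (auto simp: twisted_ngons_mass_def)
  then have "twisted_ngons_central N a b m h \<theta> \<longleftrightarrow> (\<exists>l. \<forall>k\<in>?I. F k = - (l * ?\<mu> k) *\<^sub>R (?x k - ?c))"
    unfolding twisted_ngons_central_def central_configuration_def Let_def
      center_of_mass_twisted_ngons[OF N b m] F_def by simp
  also have "\<dots> \<longleftrightarrow> (\<exists>l. m * (b * (a * C1 - C0) - ngon_A N) = - l \<and> S = 0 \<and> (h = 0 \<or> m * (1 + b) * C0 = l)
      \<and> m * (C1 - a * C0 - b * ngon_A N / a\<^sup>2) = - l * a)"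
  proof -
    have "1 \<in> {1..N}" using N by simp
    moreover have "(\<forall>k\<in>?I. P k) \<longleftrightarrow> (\<forall>k\<in>{1..N}. P (Inl k)) \<and> (\<forall>k\<in>{1..N}. P (Inr k))" for P
      by auto
    ultimately have *: "(\<forall>k\<in>?I. P k) \<longleftrightarrow> P1 \<and> P2"
      if "\<And>k. k \<in> {1..N} \<Longrightarrow> P (Inl k) \<longleftrightarrow> P1" "\<And>k. k \<in> {1..N} \<Longrightarrow> P (Inr k) \<longleftrightarrow> P2" for P P1 P2
      using that by blast
    show ?thesis by (subst *[OF lower upper]) auto
  qed
  also have "\<dots> \<longleftrightarrow> ?R"
  proof
    assume "\<exists>l. m * (b * (a * C1 - C0) - ngon_A N) = - l \<and> S = 0 \<and> (h = 0 \<or> m * (1 + b) * C0 = l)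
      \<and> m * (C1 - a * C0 - b * ngon_A N / a\<^sup>2) = - l * a"
    then obtain l where l: "m * (b * (a * C1 - C0) - ngon_A N) = - l" "S = 0" "h = 0 \<or> m * (1 + b) * C0 = l"
      "m * (C1 - a * C0 - b * ngon_A N / a\<^sup>2) = - l * a" by blast
    \<comment> \<open>The multiplier is proportional to \<open>m\<close>; this normalization removes
      the mass from the equations.\<close>
    define l' where "l' = l / m"
    have l': "l = m * l'" using m by (simp add: l'_def)
    have "m * (b * (a * C1 - C0) - ngon_A N) = m * - l'" "h = 0 \<or> m * ((1 + b) * C0) = m * l'"
      "m * (C1 - a * C0 - b * ngon_A N / a\<^sup>2) = m * (- l' * a)"
      using l by (auto simp: l' mult_ac)
    then have "b * (a * C1 - C0) - ngon_A N = - l'" "h = 0 \<or> (1 + b) * C0 = l'"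
      "C1 - a * C0 - b * ngon_A N / a\<^sup>2 = - l' * a"
      using m by (simp_all only: mult_left_cancel less_imp_neq[OF m, symmetric] not_False_eq_True)
    then show ?R using l(2) by (intro conjI exI[of _ l']) (auto simp: algebra_simps)
  next
    assume ?R
    then obtain l where l: "ngon_A N = l - b * (C0 - a * C1)" "b * ngon_A N / a\<^sup>2 = a * l - (a * C0 - C1)"
      "h = 0 \<or> (1 + b) * C0 = l" "S = 0" by (auto simp: algebra_simps)
    show "\<exists>l. m * (b * (a * C1 - C0) - ngon_A N) = - l \<and> S = 0 \<and> (h = 0 \<or> m * (1 + b) * C0 = l)
      \<and> m * (C1 - a * C0 - b * ngon_A N / a\<^sup>2) = - l * a"
      using l(3,4) unfolding l(2) by (intro exI[of _ "m * l"]) (auto simp: l(1) algebra_simps)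
  qed
  finally show ?thesis .
qed

section \<open>The admissible twist angles and the elimination of the multiplier\<close>

lemma cross_sum_sin_eq_0_iff:
  fixes a h \<theta> :: real
  assumes "0 < N" "0 < a" "h \<noteq> 0 \<or> a \<noteq> 1" "0 \<le> \<theta>" "\<theta> < 2 * pi / real N"
  shows "cross_sum sin N a h \<theta> = 0 \<longleftrightarrow> \<theta> = 0 \<or> \<theta> = pi / real N"
proof -
  \<comment> \<open>This sum of squares is the excess of \<open>1 + a\<^sup>2 + h\<^sup>2\<close>
    over \<open>2 * a\<close>, so no distance between the layers vanishes.\<close>
  have "0 < (1 - a)\<^sup>2 + h\<^sup>2" using assms(3) by (auto simp: sum_power2_gt_zero_iff)
  then have "2 * a < 1 + a\<^sup>2 + h\<^sup>2" by (simp add: power2_eq_square algebra_simps)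
  from sum_sin_over_ngon_powr_eq_0_iff[OF assms(1,2) this, of \<theta>]
  have "cross_sum sin N a h \<theta> = 0 \<longleftrightarrow> sin (real N * \<theta>) = 0"
    by (simp add: cross_sum_def algebra_simps)
  also have "\<dots> \<longleftrightarrow> real N * \<theta> = 0 \<or> real N * \<theta> = pi"
  proof -
    have "0 \<le> real N * \<theta>" "real N * \<theta> < 2 * pi" using assms by (auto simp: field_simps)
    then show ?thesis
      \<comment> \<open>Shifting by \<open>pi\<close> moves the angle into the open interval from
        \<open>- pi\<close> to \<open>pi\<close>, once the endpoint \<open>N\<theta> = 0\<close> is
        split off.\<close>
      using sin_eq_0_pi[of "real N * \<theta> - pi"]
      by (cases "real N * \<theta> = 0") (auto simp: sin_diff simp del: mult_eq_0_iff)
  qed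
  also have "\<dots> \<longleftrightarrow> \<theta> = 0 \<or> \<theta> = pi / real N" using assms(1) by (auto simp: field_simps)
  finally show ?thesis .
qed

text \<open>Without a vertical equation, the radial equation of the lower polygon determines the
  multiplier. Substituting it into that of the upper polygon leaves a single condition.\<close>

lemma coplanar_ngons_central_iff:
  assumes "2 \<le> N" "0 < a" "0 < b" "0 < m" "a \<noteq> 1" "0 \<le> \<theta>" "\<theta> < 2 * pi / real N"
  shows "twisted_ngons_central N a b m 0 \<theta> \<longleftrightarrow> (\<theta> = 0 \<or> \<theta> = pi / real N) \<and>
    b * (cross_sum (\<lambda>x. 1 - a * cos x) N a 0 \<theta> - ngon_A N / a ^ 3)
      = cross_sum (\<lambda>x. 1 - inverse a * cos x) N a 0 \<theta> - ngon_A N"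
proof -
  have lin: "cross_sum (\<lambda>x. 1 - c * cos x) N a 0 \<theta> = cross_sum (\<lambda>_. 1) N a 0 \<theta> - c * cross_sum cos N a 0 \<theta>" for c
    by (simp add: cross_sum_def diff_divide_distrib sum_subtractf sum_distrib_left)
  have "b * A / a\<^sup>2 + a * C0 - C1 = a * (A + b * (C0 - a * C1))
      \<longleftrightarrow> b * (C0 - a * C1 - A / a ^ 3) = C0 - inverse a * C1 - A" for A C0 C1 :: real
  proof -
    have "b * A / a\<^sup>2 + a * C0 - C1 - a * (A + b * (C0 - a * C1))
        = a * (C0 - inverse a * C1 - A - b * (C0 - a * C1 - A / a ^ 3))"
      using assms(2) by (simp add: field_simps power2_eq_square power3_eq_cube)
    then show ?thesis using assms(2) by auto
  qed
  then show ?thesis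
    using assms cross_sum_sin_eq_0_iff[of N a 0 \<theta>] by (simp add: twisted_ngons_central_iff lin)
qed

text \<open>Here the vertical equation fixes the multiplier as \<open>(1 + b) * C0\<close>, with
  \<open>C0\<close> the cross sum of weight 1, and both radial equations survive as
  conditions.\<close>

lemma separated_ngons_central_iff:
  assumes "2 \<le> N" "0 < a" "0 < b" "0 < m" "h \<noteq> 0" "0 \<le> \<theta>" "\<theta> < 2 * pi / real N"
  shows "twisted_ngons_central N a b m h \<theta> \<longleftrightarrow> (\<theta> = 0 \<or> \<theta> = pi / real N) \<and>
    b * a * cross_sum cos N a h \<theta> = ngon_A N - cross_sum (\<lambda>_. 1) N a h \<theta> \<and>
    b * a * (ngon_A N / a ^ 3 - cross_sum (\<lambda>_. 1) N a h \<theta>) = cross_sum cos N a h \<theta>"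
proof -
  have "b * A / a\<^sup>2 + a * C0 - C1 = a * ((1 + b) * C0) \<longleftrightarrow> b * a * (A / a ^ 3 - C0) = C1" for A C0 C1 :: real
  proof -
    have "b * A / a\<^sup>2 + a * C0 - C1 - a * ((1 + b) * C0) = b * a * (A / a ^ 3 - C0) - C1"
      using assms(2) by (simp add: field_simps power2_eq_square power3_eq_cube)
    then show ?thesis by auto
  qed
  moreover have "A + b * (C0 - a * C1) = (1 + b) * C0 \<longleftrightarrow> b * a * C1 = A - C0" for A C0 C1 :: real
    by (auto simp: algebra_simps)
  moreover have "twisted_ngons_central N a b m h \<theta> \<longleftrightarrow> cross_sum sin N a h \<theta> = 0 \<and>
    ngon_A N + b * (cross_sum (\<lambda>_. 1) N a h \<theta> - a * cross_sum cos N a h \<theta>) = (1 + b) * cross_sum (\<lambda>_. 1) N a h \<theta> \<and>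
    b * ngon_A N / a\<^sup>2 + a * cross_sum (\<lambda>_. 1) N a h \<theta> - cross_sum cos N a h \<theta>
      = a * ((1 + b) * cross_sum (\<lambda>_. 1) N a h \<theta>)"
    using twisted_ngons_central_iff[OF assms(1-4)] assms(5) by auto
  moreover have "cross_sum sin N a h \<theta> = 0 \<longleftrightarrow> \<theta> = 0 \<or> \<theta> = pi / real N"
    using assms by (intro cross_sum_sin_eq_0_iff) auto
  ultimately show ?thesis by (simp only:)
qed

theorem corollary1p10:
  fixes N :: nat and a b m h \<theta> :: real
  assumes "2 \<le> N" and "0 < a" and "0 < b" and "0 < m" and "0 \<le> h"
    and "0 \<le> \<theta>" and "\<theta> < 2 * pi / N"
  shows "(h = 0 \<and> a \<noteq> 1 \<longrightarrow>
    (twisted_ngons_central N a b m h \<theta> \<longleftrightarrow>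
      (\<theta> = 0 \<and>
        b * ((\<Sum>j\<in>{1..N}. (1 - a * cos (ngon_angle N j)) / (1 + a\<^sup>2 - 2 * a * cos (ngon_angle N j)) powr (3/2))
               - ngon_A N / a ^ 3)
          = (\<Sum>j\<in>{1..N}. (1 - inverse a * cos (ngon_angle N j)) / (1 + a\<^sup>2 - 2 * a * cos (ngon_angle N j)) powr (3/2))
               - ngon_A N) \<or>
      (\<theta> = pi / N \<and>
        b * ((\<Sum>j\<in>{1..N}. (1 - a * cos (ngon_angle N j + pi / N)) / (1 + a\<^sup>2 - 2 * a * cos (ngon_angle N j + pi / N)) powr (3/2))
               - ngon_A N / a ^ 3)
          = (\<Sum>j\<in>{1..N}. (1 - inverse a * cos (ngon_angle N j + pi / N)) / (1 + a\<^sup>2 - 2 * a * cos (ngon_angle N j + pi / N)) powr (3/2))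
               - ngon_A N))) \<and>
   (h > 0 \<longrightarrow>
    (twisted_ngons_central N a b m h \<theta> \<longleftrightarrow>
      (\<theta> = 0 \<and>
        b * a * (\<Sum>j\<in>{1..N}. cos (ngon_angle N j) / (1 + a\<^sup>2 - 2 * a * cos (ngon_angle N j) + h\<^sup>2) powr (3/2))
          = ngon_A N - (\<Sum>j\<in>{1..N}. 1 / (1 + a\<^sup>2 - 2 * a * cos (ngon_angle N j) + h\<^sup>2) powr (3/2)) \<and>
        b * a * (ngon_A N / a ^ 3 - (\<Sum>j\<in>{1..N}. 1 / (1 + a\<^sup>2 - 2 * a * cos (ngon_angle N j) + h\<^sup>2) powr (3/2)))
          = (\<Sum>j\<in>{1..N}. cos (ngon_angle N j) / (1 + a\<^sup>2 - 2 * a * cos (ngon_angle N j) + h\<^sup>2) powr (3/2))) \<or>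
      (\<theta> = pi / N \<and>
        b * a * (\<Sum>j\<in>{1..N}. cos (ngon_angle N j + pi / N) / (1 + a\<^sup>2 - 2 * a * cos (ngon_angle N j + pi / N) + h\<^sup>2) powr (3/2))
          = ngon_A N - (\<Sum>j\<in>{1..N}. 1 / (1 + a\<^sup>2 - 2 * a * cos (ngon_angle N j + pi / N) + h\<^sup>2) powr (3/2)) \<and>
        b * a * (ngon_A N / a ^ 3 - (\<Sum>j\<in>{1..N}. 1 / (1 + a\<^sup>2 - 2 * a * cos (ngon_angle N j + pi / N) + h\<^sup>2) powr (3/2)))
          = (\<Sum>j\<in>{1..N}. cos (ngon_angle N j + pi / N) / (1 + a\<^sup>2 - 2 * a * cos (ngon_angle N j + pi / N) + h\<^sup>2) powr (3/2)))))"
  using coplanar_ngons_central_iff[of N a b m \<theta>] separated_ngons_central_iff[of N a b m h \<theta>] assms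
  by (auto simp: cross_sum_def)

end
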